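(* Let $f:\mathbb{R}^{n_1}\times\cdots\times\mathbb{R}^{n_m}\to\mathbb{R}$ be convex and differentiable, and suppose there are constants $L_1,\dots,L_m>0$ such that for each $i\in\{1,\dots,m\}$, the partial gradient $\nabla_i f$ is $L_i$-Lipschitz in the $i$-th block when all other blocks are fixed, i.e. $$\|\nabla_i f(x_1,\dots,x_i^1,\dots,x_m)-\nabla_i f(x_1,\dots,x_i^2,\dots,x_m)\|\le L_i\|x_i^1-x_i^2\|$$ for all $x_j$ ($j\ne i$), $x_i^1,x_i^2$. Let each $g_i:\mathbb{R}^{n_i}\to\mathbb{R}\cup\{+\infty\}$ be proper, lower semicontinuous and convex, and let $F(x)=f(x)+\sum_{i=1}^m g_i(x_i)$. Suppose $\min F$ is finite and $F$ is coercive. For each $i$ let $(\beta_{k,i})_{k\ge 0}\subseteq[0,1)$ be non-increasing, and suppose there are constants $\underline\beta,\overline\beta$ with $$0<\underline\beta\le\beta_{k,i}\le\overline\beta<1\quad\text{for all }k\text{ and }i.$$ Fix $0<c<1$ and set $\gamma_{k,i}=\frac{2(1-\beta_{k,i})c}{L_i}$. Let $(x^k)_{k\ge 0}$ be generated, from given initial points $x^0,x^1$, by the cyclic scheme: for each $k\ge 1$ and $i=1,\dots,m$ in order, $$x_i^{k+1}=\mathbf{prox}_{\gamma_{k,i}g_i}\left[x_i^k-\gamma_{k,i}\nabla_i f(x_1^{k+1},\dots,x_{i-1}^{k+1},x_i^k,\dots,x_m^k)+\beta_{k,i}(x_i^k-x_i^{k-1})\right].$$ Then $$F(x^k)-\min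 F=O\left(\frac1k\right)\quad\text{as }k\to\infty.$$
   Context: $\|\cdot\|$ is the Euclidean norm; $x=(x_1,\dots,x_m)$ with $x_i\in\mathbb{R}^{n_i}$; $\nabla_i f$ is the gradient with respect to block $i$; $\mathbf{prox}_{\gamma h}(y)=\arg\min_z\{h(z)+\frac{1}{2\gamma}\|z-y\|^2\}$. Coercive means $F(x)\to+\infty$ as $\|x\|\to\infty$. $\min F$ denotes the minimum value of $F$, attained on the nonempty set $\arg\min F$. *)

theory Defs
  imports "HOL-Analysis.Analysis" "HOL-Library.Landau_Symbols"
begin

text \<open>
  The product of the spaces \<open>\<real>\<^sup>n\<^sup>i\<close>, \<open>i = 1, \<dots>, m\<close>, with block sizes that may differ, is
  represented as \<open>real ^ 'n\<close> with \<open>CARD('n)\<close> the sum of the block sizes, together with a map \<open>b\<close>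
  sending each coordinate to the number of its block, so that block \<open>i\<close> has dimension
  \<open>card {j. b j = i}\<close>. The factor \<open>\<real>\<^sup>n\<^sup>i\<close> is identified, isometrically, with the subspace
  \<open>block_space b i\<close> of vectors supported on the coordinates of block \<open>i\<close>.
\<close>

definition block_space :: "('n::finite \<Rightarrow> nat) \<Rightarrow> nat \<Rightarrow> (real ^ 'n) set" where
  "block_space b i = {v. \<forall>j. b j \<noteq> i \<longrightarrow> v $ j = 0}"

definition block :: "('n::finite \<Rightarrow> nat) \<Rightarrow> nat \<Rightarrow> real ^ 'n \<Rightarrow> real ^ 'n" where
  "block b i x = (\<chi> j. if b j = i then x $ j else 0)"

definition block_update ::
    "('n::finite \<Rightarrow> nat) \<Rightarrow> nat \<Rightarrow> real ^ 'n \<Rightarrow> real ^ 'n \<Rightarrow> real ^ 'n" where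
  "block_update b i x z = (\<chi> j. if b j = i then z $ j else x $ j)"

definition splice_blocks ::
    "('n::finite \<Rightarrow> nat) \<Rightarrow> nat \<Rightarrow> real ^ 'n \<Rightarrow> real ^ 'n \<Rightarrow> real ^ 'n" where
  "splice_blocks b i y x = (\<chi> j. if b j < i then y $ j else x $ j)"

definition partial_grad ::
    "('n::finite \<Rightarrow> nat) \<Rightarrow> nat \<Rightarrow> (real ^ 'n \<Rightarrow> real) \<Rightarrow> real ^ 'n \<Rightarrow> real ^ 'n" where
  "partial_grad b i f x = (THE D. D \<in> block_space b i \<and>
     ((\<lambda>z. f (block_update b i x z)) has_derivative (\<lambda>h. D \<bullet> h))
       (at (block b i x) within block_space b i))"

text \<open>
  The following notions for extended-real-valued functions are relative to a subspace \<open>V\<close>; values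
  outside \<open>V\<close> are irrelevant. In \<open>convex_ext\<close> the products with coefficient \<open>0\<close> are
  harmless, since \<open>0 * \<infinity> = 0\<close> in \<^typ>\<open>ereal\<close>.
\<close>

definition proper_ext :: "'a set \<Rightarrow> ('a \<Rightarrow> ereal) \<Rightarrow> bool" where
  "proper_ext V h \<longleftrightarrow> (\<forall>z\<in>V. h z \<noteq> -\<infinity>) \<and> (\<exists>z\<in>V. h z \<noteq> \<infinity>)"

definition lsc_ext :: "'a::topological_space set \<Rightarrow> ('a \<Rightarrow> ereal) \<Rightarrow> bool" where
  "lsc_ext V h \<longleftrightarrow> (\<forall>z\<in>V. h z \<le> Liminf (at z within V) h)"

definition convex_ext :: "'a::real_vector set \<Rightarrow> ('a \<Rightarrow> ereal) \<Rightarrow> bool" where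
  "convex_ext V h \<longleftrightarrow> (\<forall>y\<in>V. \<forall>z\<in>V. \<forall>t\<in>{0..1}.
     h ((1 - t) *\<^sub>R y + t *\<^sub>R z) \<le> ereal (1 - t) * h y + ereal t * h z)"

definition prox :: "'a::real_normed_vector set \<Rightarrow> real \<Rightarrow> ('a \<Rightarrow> ereal) \<Rightarrow> 'a \<Rightarrow> 'a" where
  "prox V \<gamma> h y = (ARG_MIN (\<lambda>z. h z + ereal (1 / (2 * \<gamma>) * (norm (z - y))\<^sup>2)) z. z \<in> V)"

end

theory Submission
  imports Defs
begin

text \<open>
  Each proximal block step, combined with the blockwise descent inequality for \<open>f\<close>, makes
  \<open>\<xi>\<^sub>k = F(x\<^sup>k) + \<Sum>\<^sub>i \<beta>\<^sub>k\<^sub>,\<^sub>i / (2 \<gamma>\<^sub>k\<^sub>,\<^sub>i) \<parallel>x\<^sub>i\<^sup>k - x\<^sub>i\<^sup>k\<^sup>-\<^sup>1\<parallel>\<^sup>2\<close> decrease by at least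
  \<open>\<kappa> \<parallel>x\<^sup>k\<^sup>+\<^sup>1 - x\<^sup>k\<parallel>\<^sup>2\<close>. Coercivity then bounds the iterates. A convex blockwise smooth function has a
  globally Lipschitz gradient, so the convexity inequalities at a minimizer give
  \<open>\<xi>\<^sub>k\<^sub>+\<^sub>1 - min F \<le> B (\<parallel>x\<^sup>k\<^sup>+\<^sup>1 - x\<^sup>k\<parallel> + \<parallel>x\<^sup>k - x\<^sup>k\<^sup>-\<^sup>1\<parallel>)\<close>. Together, \<open>a\<^sub>k = \<xi>\<^sub>k - min F\<close> satisfies
  \<open>a\<^sub>k\<^sub>+\<^sub>2\<^sup>2 \<le> C (a\<^sub>k - a\<^sub>k\<^sub>+\<^sub>2)\<close>, whence \<open>a\<^sub>k = O(1/k)\<close>. Since the starting points need not lie in the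
  effective domain, the argument starts at \<open>k = 2\<close>.
\<close>

section \<open>Existence and variational inequality for the proximal map\<close>

text \<open>Direct method: a minimizing sequence in \<open>K\<close> has a convergent subsequence,
  and lower semicontinuity of \<open>h\<close> at its limit shows that the infimum is attained
  there.\<close>

lemma lsc_plus_continuous_attains_inf:
  fixes h :: "'a::metric_space \<Rightarrow> ereal" and q :: "'a \<Rightarrow> real"
  assumes lsc: "lsc_ext V h" and K: "compact K" "K \<subseteq> V" "K \<noteq> {}"
    and q: "continuous_on K q"
  obtains z where "z \<in> K" "\<And>w. w \<in> K \<Longrightarrow> h z + ereal (q z) \<le> h w + ereal (q w)"
proof -
  define \<phi> where "\<phi> w = h w + ereal (q w)" for w
  obtain u where u: "\<And>n. u n \<in> \<phi> ` K" "u \<longlonglongrightarrow> Inf (\<phi> ` K)"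
    using Inf_as_limit[of "\<phi> ` K"] K(3) by blast
  have "\<exists>w. w \<in> K \<and> \<phi> w = u n" for n
    using u(1)[of n] by (auto simp: image_iff)
  then obtain w where w: "\<And>n. w n \<in> K" "\<And>n. \<phi> (w n) = u n" by metis
  obtain z r where z: "z \<in> K" "strict_mono r" "(w \<circ> r) \<longlonglongrightarrow> z"
    using K(1) w(1) unfolding compact_def by metis
  have q_lim: "(\<lambda>n. q (w (r n))) \<longlonglongrightarrow> q z"
    using q z w(1) unfolding continuous_on_sequentially by (auto simp: comp_def)
  have "(\<lambda>n. \<phi> (w (r n))) \<longlonglongrightarrow> Inf (\<phi> ` K)"
    using LIMSEQ_subseq_LIMSEQ[OF u(2) z(2)] w(2) by (simp add: comp_def)
  \<comment> \<open>As \<open>q\<close> is real-valued, it can be subtracted even if the infimum is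
    infinite; this isolates \<open>h\<close>, the only part that is merely lower
    semicontinuous.\<close>
  then have "(\<lambda>n. \<phi> (w (r n)) + ereal (- q (w (r n)))) \<longlonglongrightarrow> Inf (\<phi> ` K) + ereal (- q z)"
    using q_lim by (intro tendsto_add_ereal_general) (auto intro: tendsto_minus)
  moreover have "\<phi> v + ereal (- q v) = h v" for v
    unfolding \<phi>_def by (cases "h v") auto
  ultimately have h_lim: "(\<lambda>n. h (w (r n))) \<longlonglongrightarrow> Inf (\<phi> ` K) + ereal (- q z)" by simp
  have "h z \<le> Inf (\<phi> ` K) + ereal (- q z)"
  proof (rule ccontr)
    assume "\<not> ?thesis"
    then obtain t where t: "Inf (\<phi> ` K) + ereal (- q z) < t" "t < h z"
      using dense not_le by metis
    have "z \<in> V" using z(1) K(2) by auto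
    then have "t < Liminf (at z within V) h"
      using lsc t(2) unfolding lsc_ext_def by (meson less_le_trans)
    then have "\<forall>\<^sub>F v in at z within V. t < h v"
      by (rule less_LiminfD)
    \<comment> \<open>The filter \<open>at z within V\<close> omits \<open>z\<close> itself, which
      the subsequence may hit; there the bound is \<open>t < h z\<close>.\<close>
    then have "\<forall>\<^sub>F v in nhds z. v \<in> V \<longrightarrow> t < h v"
      using t(2) unfolding eventually_at_filter by (auto elim: eventually_mono)
    then have "\<forall>\<^sub>F n in sequentially. w (r n) \<in> V \<longrightarrow> t < h (w (r n))"
      using z(3) unfolding filterlim_iff comp_def by auto
    moreover have "\<forall>\<^sub>F n in sequentially. h (w (r n)) < t"
      using order_tendstoD(2)[OF h_lim t(1)] .
    ultimately have "\<forall>\<^sub>F n in sequentially. False"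
      by eventually_elim (use w(1) K(2) in force)
    then show False by simp
  qed
  then have "\<phi> z \<le> Inf (\<phi> ` K)"
    unfolding \<phi>_def by (cases "h z"; cases "Inf ((\<lambda>w. h w + ereal (q w)) ` K)") auto
  then have "\<phi> z \<le> \<phi> v" if "v \<in> K" for v
    using that by (meson INF_lower order_trans)
  then show ?thesis using that z(1) unfolding \<phi>_def by blast
qed

text \<open>
  Boundedness below near a point of the effective domain propagates to linear growth along rays,
  so the quadratic term of the proximal problem dominates.
\<close>

lemma prox_is_arg_min:
  fixes V :: "'a::euclidean_space set"
  assumes V: "subspace V" and proper: "proper_ext V h" and lsc: "lsc_ext V h"
    and conv: "convex_ext V h" and \<gamma>: "\<gamma> > 0"
  shows "is_arg_min (\<lambda>z. h z + ereal (1 / (2 * \<gamma>) * (norm (z - y))\<^sup>2)) (\<lambda>z. z \<in> V) (prox V \<gamma> h y)"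
proof -
  define s where "s = 1 / (2 * \<gamma>)"
  have s: "s > 0" using \<gamma> by (simp add: s_def)
  let ?\<phi> = "\<lambda>z. h z + ereal (s * (norm (z - y))\<^sup>2)"
  obtain z0 where z0: "z0 \<in> V" "h z0 \<noteq> \<infinity>" and ninf: "\<And>z. z \<in> V \<Longrightarrow> h z \<noteq> -\<infinity>"
    using proper unfolding proper_ext_def by blast
  obtain h0 where h0: "h z0 = ereal h0" using z0 ninf[of z0] by (cases "h z0") auto
  have cpt: "compact (V \<inter> cball z0 r)" for r
    using closed_subspace[OF V] by (simp add: closed_Int_compact)
  \<comment> \<open>The minimum of \<open>h\<close> over the unit ball around \<open>z0\<close> is a
    finite lower bound \<open>M\<close> near \<open>z0\<close>.\<close>
  obtain zm where zm: "zm \<in> V \<inter> cball z0 1" "\<And>w. w \<in> V \<inter> cball z0 1 \<Longrightarrow> h zm \<le> h w"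
  proof (rule lsc_plus_continuous_attains_inf[OF lsc cpt[of 1], of "\<lambda>_. 0"])
    have "z0 \<in> V \<inter> cball z0 1" using z0(1) by simp
    then show "V \<inter> cball z0 1 \<noteq> {}" by blast
  qed (auto intro: that)
  have "h zm \<le> h z0" using zm(2)[of z0] z0(1) by simp
  then obtain M where M: "h zm = ereal M"
    using h0 zm(1) ninf[of zm] by (cases "h zm") auto
  define A where "A = \<bar>M - h0\<bar>"
  define N where "N = norm (z0 - y)"
  \<comment> \<open>Chosen so that \<open>r > R\<close> gives
    \<open>A \<le> s * (r - 2 * N)\<close>: beyond radius \<open>R\<close> the quadratic term
    outweighs a linear decrease of \<open>h\<close> with slope \<open>A\<close>.\<close>
  define R where "R = 1 + 2 * N + A / s"
  have R1: "R \<ge> 1" using s by (simp add: R_def N_def A_def)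
  have far: "?\<phi> z0 \<le> ?\<phi> z" if z: "z \<in> V" "z \<notin> cball z0 R" for z
  proof (cases "h z")
    case (real hz)
    define r where "r = norm (z - z0)"
    have r: "r > R" "r > 1" using z(2) R1 by (auto simp: r_def dist_norm norm_minus_commute)
    \<comment> \<open>The point of the segment from \<open>z0\<close> to \<open>z\<close> at
      distance 1 from \<open>z0\<close>, where \<open>M\<close> bounds \<open>h\<close> from below;
      convexity carries this bound out to \<open>z\<close>.\<close>
    define v where "v = (1 - 1 / r) *\<^sub>R z0 + (1 / r) *\<^sub>R z"
    have v: "v \<in> V" unfolding v_def using V z0(1) z(1) by (intro subspace_add subspace_scale)
    have "v - z0 = (1 / r) *\<^sub>R (z - z0)" by (simp add: v_def algebra_simps)
    then have "norm (v - z0) = 1" using r(2) by (simp add: r_def[symmetric])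
    then have "v \<in> cball z0 1" by (simp add: dist_norm norm_minus_commute)
    then have "ereal M \<le> h v" using zm(2) v M by simp
    also have "\<dots> \<le> ereal (1 - 1 / r) * h z0 + ereal (1 / r) * h z"
    proof -
      have "1 / r \<in> {0..1}" using r by auto
      then show ?thesis using conv z0(1) z(1) unfolding convex_ext_def v_def by blast
    qed
    finally have "M \<le> (1 - 1 / r) * h0 + (1 / r) * hz" by (simp add: h0 real)
    then have "r * M \<le> r * ((1 - 1 / r) * h0 + (1 / r) * hz)"
      using r(2) by (intro mult_left_mono) auto
    also have "\<dots> = (r - 1) * h0 + hz" using r(2) by (simp add: field_simps)
    finally have hz: "hz \<ge> h0 + r * (M - h0)" by (simp add: algebra_simps)
    have "r * (M - h0) \<ge> - (r * A)"
      using mult_left_mono[of "- A" "M - h0" r] r(2) by (simp add: A_def)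
    moreover have "r * A \<le> s * (r * (r - 2 * N))"
    proof -
      have "A / s \<le> r - 2 * N" using r(1) by (simp add: R_def)
      then have "A \<le> s * (r - 2 * N)" using s by (simp add: field_simps)
      then have "r * A \<le> r * (s * (r - 2 * N))" using r(2) by (intro mult_left_mono) auto
      then show ?thesis by (simp add: algebra_simps)
    qed
    moreover have "s * (r - N)\<^sup>2 \<le> s * (norm (z - y))\<^sup>2"
    proof -
      have "r \<le> norm (z - y) + N"
        using norm_triangle_ineq4[of "z - y" "z0 - y"] by (simp add: r_def N_def)
      moreover have "r \<ge> N" using r(1) s by (auto simp: R_def N_def A_def
          intro: order_trans[of _ "1 + 2 * norm (z0 - y) + \<bar>M - h0\<bar> / s"])
      ultimately show ?thesis using s by (intro mult_left_mono power_mono) auto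
    qed
    moreover have "s * (r - N)\<^sup>2 = s * (r * (r - 2 * N)) + s * N\<^sup>2"
      by (simp add: power2_eq_square algebra_simps)
    ultimately have "h0 + s * N\<^sup>2 \<le> hz + s * (norm (z - y))\<^sup>2" using hz by linarith
    then show ?thesis by (simp add: h0 real N_def)
  next
    case PInf then show ?thesis by simp
  next
    case MInf then show ?thesis using ninf z(1) by simp
  qed
  have z0R: "z0 \<in> V \<inter> cball z0 R" using R1 z0 by simp
  obtain p where p: "p \<in> V \<inter> cball z0 R" "\<And>w. w \<in> V \<inter> cball z0 R \<Longrightarrow> ?\<phi> p \<le> ?\<phi> w"
  proof (rule lsc_plus_continuous_attains_inf[OF lsc cpt[of R], of "\<lambda>z. s * (norm (z - y))\<^sup>2"])
    show "V \<inter> cball z0 R \<noteq> {}" using z0R by blast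
  qed (auto intro!: continuous_intros that)
  have "?\<phi> p \<le> ?\<phi> z" if "z \<in> V" for z
  proof (cases "z \<in> cball z0 R")
    case True then show ?thesis using p(2)[of z] that by simp
  next
    case False
    then show ?thesis using far[OF that] p(2)[OF z0R] order_trans by blast
  qed
  then have "is_arg_min ?\<phi> (\<lambda>z. z \<in> V) p"
    using p(1) by (auto simp: is_arg_min_linorder)
  \<comment> \<open>\<open>ARG_MIN\<close> is a choice operator, so the existence of the minimizer
    \<open>p\<close> yields the property for \<open>prox\<close>.\<close>
  then show ?thesis
    unfolding prox_def arg_min_def s_def by (rule someI)
qed

text \<open>\<open>(y - p) / \<gamma>\<close> is a subgradient of \<open>h\<close> at
  \<open>p\<close> relative to \<open>V\<close>: compare \<open>p\<close> with the point a fraction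
  \<open>t\<close> of the way to \<open>z\<close>, divide by \<open>t\<close>, and let
  \<open>t\<close> tend to 0 from the right, so that the quadratic remainder vanishes.\<close>

lemma prox_variational:
  fixes V :: "'a::euclidean_space set"
  assumes V: "subspace V" and proper: "proper_ext V h" and lsc: "lsc_ext V h"
    and conv: "convex_ext V h" and \<gamma>: "\<gamma> > 0" and p: "p = prox V \<gamma> h y"
  shows "p \<in> V" and "\<bar>h p\<bar> \<noteq> \<infinity>"
    and "\<And>z. z \<in> V \<Longrightarrow> \<bar>h z\<bar> \<noteq> \<infinity> \<Longrightarrow>
      real_of_ereal (h p) + (1 / \<gamma>) * ((y - p) \<bullet> (z - p)) \<le> real_of_ereal (h z)"
proof -
  define s where "s = 1 / (2 * \<gamma>)"
  let ?\<phi> = "\<lambda>z. h z + ereal (s * (norm (z - y))\<^sup>2)"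
  have "is_arg_min ?\<phi> (\<lambda>z. z \<in> V) p"
    using prox_is_arg_min[OF V proper lsc conv \<gamma>] unfolding p s_def by blast
  then have pV: "p \<in> V" and min: "\<And>z. z \<in> V \<Longrightarrow> ?\<phi> p \<le> ?\<phi> z"
    by (auto simp: is_arg_min_linorder)
  obtain z0 where z0: "z0 \<in> V" "h z0 \<noteq> \<infinity>" using proper unfolding proper_ext_def by blast
  have "h p \<noteq> -\<infinity>" using proper pV unfolding proper_ext_def by blast
  moreover have "h p \<noteq> \<infinity>" using min[OF z0(1)] z0(2) by (cases "h z0") auto
  ultimately show fin: "\<bar>h p\<bar> \<noteq> \<infinity>" by auto
  show "p \<in> V" by fact
  fix z assume z: "z \<in> V" "\<bar>h z\<bar> \<noteq> \<infinity>"
  obtain hp where hp: "h p = ereal hp" using fin by auto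
  obtain hz where hz: "h z = ereal hz" using z(2) by auto
  have pos: "0 \<le> (hz - hp + (1 / \<gamma>) * ((p - y) \<bullet> (z - p))) + t * (s * (norm (z - p))\<^sup>2)"
    if t: "0 < t" "t \<le> 1" for t
  proof -
    define v where "v = (1 - t) *\<^sub>R p + t *\<^sub>R z"
    have v: "v \<in> V" unfolding v_def using V pV z(1) by (intro subspace_add subspace_scale)
    have "h v \<le> ereal (1 - t) * h p + ereal t * h z"
      using conv pV z(1) t unfolding convex_ext_def v_def by auto
    then have hv: "h v \<le> ereal ((1 - t) * hp + t * hz)" by (simp add: hp hz)
    have "?\<phi> p \<le> ?\<phi> v" using min v by blast
    also have "\<dots> \<le> ereal ((1 - t) * hp + t * hz) + ereal (s * (norm (v - y))\<^sup>2)"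
      using hv by (intro add_mono) auto
    finally have 1: "hp + s * (norm (p - y))\<^sup>2 \<le> (1 - t) * hp + t * hz + s * (norm (v - y))\<^sup>2"
      by (simp add: hp)
    have "v - y = (p - y) + t *\<^sub>R (z - p)" by (simp add: v_def algebra_simps)
    then have "(norm (v - y))\<^sup>2 = (norm (p - y))\<^sup>2 + 2 * t * ((p - y) \<bullet> (z - p)) + t\<^sup>2 * (norm (z - p))\<^sup>2"
      by (simp only: power2_norm_eq_inner)
         (simp add: inner_commute power2_eq_square inner_add_left inner_add_right algebra_simps)
    then have "s * (norm (v - y))\<^sup>2 = s * (norm (p - y))\<^sup>2
        + s * (2 * t * ((p - y) \<bullet> (z - p)) + t\<^sup>2 * (norm (z - p))\<^sup>2)"
      by (simp only: distrib_left add.assoc)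
    then have "0 \<le> t * (hz - hp) + s * (2 * t * ((p - y) \<bullet> (z - p)) + t\<^sup>2 * (norm (z - p))\<^sup>2)"
      using 1 by (simp add: left_diff_distrib right_diff_distrib)
    also have "\<dots> = t * ((hz - hp + 2 * s * ((p - y) \<bullet> (z - p))) + t * (s * (norm (z - p))\<^sup>2))"
      by (simp add: distrib_left power2_eq_square mult_ac)
    finally show ?thesis using t by (simp add: zero_le_mult_iff s_def)
  qed
  have "((\<lambda>t. (hz - hp + (1 / \<gamma>) * ((p - y) \<bullet> (z - p))) + t * (s * (norm (z - p))\<^sup>2))
      \<longlongrightarrow> (hz - hp + (1 / \<gamma>) * ((p - y) \<bullet> (z - p))) + 0 * (s * (norm (z - p))\<^sup>2)) (at_right 0)"
    by (intro tendsto_intros)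
  moreover have "\<forall>\<^sub>F t in at_right (0::real). t \<le> 1"
    unfolding eventually_at_right_field by (auto intro: exI[of _ 1])
  then have "\<forall>\<^sub>F t in at_right 0.
      0 \<le> (hz - hp + (1 / \<gamma>) * ((p - y) \<bullet> (z - p))) + t * (s * (norm (z - p))\<^sup>2)"
    using eventually_at_right_less[of 0] by eventually_elim (rule pos)
  ultimately have "0 \<le> (hz - hp + (1 / \<gamma>) * ((p - y) \<bullet> (z - p))) + 0 * (s * (norm (z - p))\<^sup>2)"
    by (intro tendsto_lowerbound) auto
  then show "real_of_ereal (h p) + (1 / \<gamma>) * ((y - p) \<bullet> (z - p)) \<le> real_of_ereal (h z)"
    by (simp add: hp hz inner_diff_left right_diff_distrib)
qed

section \<open>Gradient inequalities for convex and smooth functions\<close>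

text \<open>On the line through \<open>x\<close> and \<open>y\<close> this is the tangent bound for
  a convex function of one real variable.\<close>

lemma convex_gradient_inequality:
  fixes f :: "'a::real_inner \<Rightarrow> real"
  assumes conv: "convex_on UNIV f" and G: "(f has_derivative (\<lambda>h. G \<bullet> h)) (at x)"
  shows "f x + G \<bullet> (y - x) \<le> f y"
proof -
  let ?\<phi> = "\<lambda>t::real. f (x + t *\<^sub>R (y - x))"
  have "convex_on UNIV ?\<phi>"
  proof (rule convex_onI)
    fix t a c :: real assume "0 < t" "t < 1"
    have "x + ((1 - t) *\<^sub>R a + t *\<^sub>R c) *\<^sub>R (y - x)
        = (1 - t) *\<^sub>R (x + a *\<^sub>R (y - x)) + t *\<^sub>R (x + c *\<^sub>R (y - x))"
      by (simp add: algebra_simps)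
    then show "?\<phi> ((1 - t) *\<^sub>R a + t *\<^sub>R c) \<le> (1 - t) * ?\<phi> a + t * ?\<phi> c"
      using convex_onD[OF conv, of t "x + a *\<^sub>R (y - x)" "x + c *\<^sub>R (y - x)"] \<open>0 < t\<close> \<open>t < 1\<close>
      by simp
  qed simp
  moreover have "(?\<phi> has_field_derivative (G \<bullet> (y - x))) (at 0)"
  proof -
    have "((\<lambda>t::real. x + t *\<^sub>R (y - x)) has_derivative (\<lambda>t. t *\<^sub>R (y - x))) (at 0)"
      by (auto intro!: derivative_eq_intros)
    moreover have "(f has_derivative (\<lambda>h. G \<bullet> h)) (at (x + 0 *\<^sub>R (y - x)))" using G by simp
    ultimately have "(?\<phi> has_derivative (\<lambda>t. G \<bullet> (t *\<^sub>R (y - x)))) (at 0)"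
      by (rule has_derivative_compose)
    then show ?thesis by (simp add: has_field_derivative_def mult.commute[of _ "G \<bullet> (y - x)"])
  qed
  ultimately have "?\<phi> 1 - ?\<phi> 0 \<ge> G \<bullet> (y - x) * (1 - 0)"
    by (intro convex_on_imp_above_tangent[of UNIV]) auto
  then show ?thesis by simp
qed

text \<open>The route is cocoercivity: the quadratic upper bound strengthens the gradient inequality
  by a multiple of the squared gradient difference.\<close>

lemma quadratic_bound_imp_gradient_lipschitz:
  fixes f :: "'a::real_inner \<Rightarrow> real"
  assumes conv: "convex_on UNIV f" and G: "\<And>x. (f has_derivative (\<lambda>h. G x \<bullet> h)) (at x)"
    and M: "M > 0" and bound: "\<And>x h. f (x + h) \<le> f x + G x \<bullet> h + M / 2 * (norm h)\<^sup>2"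
  shows "norm (G x - G y) \<le> M * norm (x - y)"
proof -
  have co: "f x + G x \<bullet> (y - x) + (norm (G y - G x))\<^sup>2 / (2 * M) \<le> f y" for x y
  proof -
    define D where "D = G y - G x"
    \<comment> \<open>The intermediate point is a gradient step of length \<open>1 / M\<close> from
      \<open>y\<close> for \<open>f\<close> minus its linearization at \<open>x\<close>; it is
      bounded below by convexity and above by \<open>bound\<close>.\<close>
    have "f x + G x \<bullet> (y + (- (1 / M)) *\<^sub>R D - x) \<le> f (y + (- (1 / M)) *\<^sub>R D)"
      by (rule convex_gradient_inequality[OF conv G])
    also have "\<dots> \<le> f y + G y \<bullet> ((- (1 / M)) *\<^sub>R D) + M / 2 * (norm ((- (1 / M)) *\<^sub>R D))\<^sup>2"
      by (rule bound)
    finally have "f x + G x \<bullet> (y - x) + (1 / M) * (G y \<bullet> D - G x \<bullet> D)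
        \<le> f y + M / 2 * ((1 / M)\<^sup>2 * (norm D)\<^sup>2)"
      by (simp add: inner_diff_right inner_add_right power_mult_distrib power_divide algebra_simps)
    moreover have "G y \<bullet> D - G x \<bullet> D = (norm D)\<^sup>2"
      by (simp add: D_def inner_diff_left[symmetric] power2_norm_eq_inner)
    moreover have "M / 2 * ((1 / M)\<^sup>2 * (norm D)\<^sup>2) = (norm D)\<^sup>2 / (2 * M)"
      using M by (simp add: power2_eq_square)
    moreover have "(1 / M) * (norm D)\<^sup>2 = (norm D)\<^sup>2 / (2 * M) + (norm D)\<^sup>2 / (2 * M)"
      using M by (simp add: field_simps)
    ultimately show ?thesis unfolding D_def by simp
  qed
  \<comment> \<open>Adding the two copies of \<open>co\<close> with \<open>x\<close> and
    \<open>y\<close> exchanged cancels the function values.\<close>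
  have "(norm (G x - G y))\<^sup>2 / M \<le> (G x - G y) \<bullet> (x - y)"
    using co[of x y] co[of y x] M
    by (simp add: norm_minus_commute inner_diff_left inner_diff_right field_simps)
  also have "\<dots> \<le> norm (G x - G y) * norm (x - y)" by (rule norm_cauchy_schwarz)
  finally have "norm (G x - G y) * norm (G x - G y) \<le> norm (G x - G y) * (M * norm (x - y))"
    using M by (simp add: field_simps power2_eq_square)
  then show ?thesis using M
    by (cases "G x = G y") (simp_all add: mult_le_cancel_left_pos)
qed

text \<open>The difference of the two sides along the ray, \<open>?\<psi>\<close>, has nonpositive
  derivative for \<open>t \<ge> 0\<close>. Only one ray is involved, so a gradient that is Lipschitz
  within one block qualifies.\<close>

lemma lipschitz_along_ray_imp_quadratic_bound:
  fixes f :: "'a::real_inner \<Rightarrow> real"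
  assumes G: "\<And>x. (f has_derivative (\<lambda>h. G x \<bullet> h)) (at x)"
    and lip: "\<And>t. t \<ge> 0 \<Longrightarrow> (G (x + t *\<^sub>R h) - G x) \<bullet> h \<le> l * t * (norm h)\<^sup>2"
  shows "f (x + h) \<le> f x + G x \<bullet> h + l / 2 * (norm h)\<^sup>2"
proof -
  let ?\<psi> = "\<lambda>t::real. f (x + t *\<^sub>R h) - t * (G x \<bullet> h) - l / 2 * t\<^sup>2 * (norm h)\<^sup>2"
  have der: "(?\<psi> has_field_derivative (G (x + t *\<^sub>R h) \<bullet> h - G x \<bullet> h - l * t * (norm h)\<^sup>2)) (at t)" for t
  proof -
    have "((\<lambda>t::real. x + t *\<^sub>R h) has_derivative (\<lambda>s. s *\<^sub>R h)) (at t)"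
      by (auto intro!: derivative_eq_intros)
    from has_derivative_compose[OF this G]
    have "((\<lambda>t. f (x + t *\<^sub>R h)) has_field_derivative (G (x + t *\<^sub>R h) \<bullet> h)) (at t)"
      by (simp add: has_field_derivative_def mult.commute[of _ "G (x + t *\<^sub>R h) \<bullet> h"])
    then show ?thesis by (auto intro!: derivative_eq_intros)
  qed
  have "?\<psi> 1 \<le> ?\<psi> 0"
    by (rule DERIV_nonpos_imp_nonincreasing) (use der lip in \<open>fastforce simp: inner_diff_left\<close>)+
  then show ?thesis by simp
qed

section \<open>A recurrence that forces the rate 1/k\<close>

text \<open>Strong induction with stride 2: a value above \<open>D / (q + 2)\<close> would need a
  larger decrease than the bound \<open>D / q\<close> two steps earlier permits.\<close>

lemma sublinear_rate_of_delayed_quadratic_decrease: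
  fixes a :: "nat \<Rightarrow> real"
  assumes C: "C > 0"
    and step: "\<And>n. n \<ge> N \<Longrightarrow> (a (n + 2))\<^sup>2 \<le> C * (a n - a (n + 2))"
  obtains D where "D > 0" "\<And>n. a (N + n) \<le> D / real (n + 1)"
proof -
  \<comment> \<open>The term \<open>6 * C\<close> drives the induction step; the other two cover the
    base cases \<open>n = 0\<close> and \<open>n = 1\<close>.\<close>
  define D where "D = 6 * C + 2 * \<bar>a N\<bar> + 2 * \<bar>a (N + 1)\<bar>"
  have D: "D > 0" "D \<ge> 6 * C" using C by (simp_all add: D_def)
  have "a (N + n) \<le> D / real (n + 1)" for n
  proof (induction n rule: less_induct)
    case (less n)
    consider "n = 0" | "n = 1" | k where "n = k + 2" by (metis One_nat_def Suc_1 add.commute add_2_eq_Suc' not0_implies_Suc)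
    then show ?case
    proof cases
      case 3
      define q where "q = real (k + 1)"
      have q: "q \<ge> 1" by (simp add: q_def)
      define t where "t = a (N + n)"
      have IH: "a (N + k) \<le> D / q" using less[of k] 3 by (simp add: q_def)
      have st: "t\<^sup>2 \<le> C * (a (N + k) - t)" using step[of "N + k"] 3 by (simp add: t_def add.assoc)
      have "t \<le> D / (q + 2)"
      proof (rule ccontr)
        assume "\<not> ?thesis"
        then have t: "t > D / (q + 2)" by simp
        have p: "D / (q + 2) > 0" using D q by simp
        have "(D / (q + 2))\<^sup>2 < C * (D / q - D / (q + 2))"
        proof -
          have "(D / (q + 2))\<^sup>2 \<le> t\<^sup>2" using t p by (intro power_mono) auto
          also have "\<dots> \<le> C * (a (N + k) - t)" by fact
          also have "\<dots> < C * (D / q - D / (q + 2))" using IH t C by (intro mult_strict_left_mono) auto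
          finally show ?thesis .
        qed
        also have "D / q - D / (q + 2) = 2 * D / (q * (q + 2))" using q by (simp add: field_simps)
        finally have *: "(D / (q + 2))\<^sup>2 < C * (2 * D / (q * (q + 2)))" .
        have nz: "q \<noteq> 0" "q + 2 \<noteq> 0" using q by auto
        have "D * (D * q) = (D / (q + 2))\<^sup>2 * (q * (q + 2)\<^sup>2)"
          using nz by (simp add: power_divide power2_eq_square)
        also have "\<dots> < C * (2 * D / (q * (q + 2))) * (q * (q + 2)\<^sup>2)"
          using * q by (intro mult_strict_right_mono) auto
        also have "\<dots> = D * (C * 2 * (q + 2))"
          using nz by (simp add: power2_eq_square)
        finally have "D * q < C * 2 * (q + 2)" using D by (simp only: mult_less_cancel_left_pos)
        \<comment> \<open>This is where \<open>q \<ge> 1\<close> enters, and it explains the factor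
          6 in \<open>D\<close>.\<close>
        moreover have "C * 2 * (q + 2) \<le> C * (6 * q)" using q C
          by (simp add: mult.assoc)
        moreover have "6 * C * q \<le> D * q" using D q by (intro mult_right_mono) auto
        ultimately show False by simp
      qed
      then show ?thesis using 3 by (simp add: t_def q_def algebra_simps)
    qed (use C in \<open>auto simp: D_def\<close>)
  qed
  then show ?thesis using that D by blast
qed

section \<open>Orthogonal decomposition into blocks, and partial gradients\<close>

lemma subspace_block_space: "subspace (block_space b i)"
  by (auto simp: block_space_def subspace_def)

lemma block_in_block_space [simp]: "block b i v \<in> block_space b i"
  by (simp add: block_def block_space_def)

lemma block_diff: "block b i (u - v) = block b i u - block b i v"
  by (simp add: block_def vec_eq_iff)

lemma inner_block_eq: "h \<in> block_space b i \<Longrightarrow> block b i u \<bullet> h = u \<bullet> h"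
  unfolding inner_vec_def block_def block_space_def by (intro sum.cong) auto

lemma norm_block_le: "norm (block b i v) \<le> norm v"
  by (rule norm_le_componentwise_cart) (simp add: block_def)

lemma sum_block: "finite I \<Longrightarrow> range b \<subseteq> I \<Longrightarrow> (\<Sum>i\<in>I. block b i v) = v"
  by (auto simp: vec_eq_iff block_def sum.delta' image_subset_iff)

lemma sum_inner_block:
  assumes "finite I" "range b \<subseteq> I"
  shows "(\<Sum>i\<in>I. block b i u \<bullet> block b i v) = u \<bullet> v"
proof -
  have "(\<Sum>i\<in>I. block b i u \<bullet> block b i v) = u \<bullet> (\<Sum>i\<in>I. block b i v)"
    by (simp add: inner_block_eq inner_sum_right)
  then show ?thesis using sum_block[OF assms] by simp
qed

lemma sum_norm_block_power2:
  assumes "finite I" "range b \<subseteq> I"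
  shows "(\<Sum>i\<in>I. (norm (block b i v))\<^sup>2) = (norm v)\<^sup>2"
  using sum_inner_block[OF assms] by (simp add: power2_norm_eq_inner)

lemma block_update_add:
  "h \<in> block_space b i \<Longrightarrow> block_update b i y (block b i y + h) = y + h"
  by (auto simp: block_update_def block_def block_space_def vec_eq_iff)

text \<open>Each stage of a cyclic sweep adds a vector of one block, so blockwise estimates can be
  telescoped over the sweep.\<close>

lemma splice_blocks_Suc:
  "splice_blocks b (Suc i) y x = splice_blocks b i y x + block b i (y - x)"
  by (auto simp: splice_blocks_def block_def vec_eq_iff less_Suc_eq)

lemma norm_diff_splice_blocks_le: "norm (y - splice_blocks b i y x) \<le> norm (y - x)"
  by (rule norm_le_componentwise_cart) (simp add: splice_blocks_def)

text \<open>Existence is the chain rule, since \<open>block_update b i x\<close> is affine with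
  linear part \<open>block b i\<close>. Uniqueness holds because the representing vector is itself
  required to lie in the block.\<close>

lemma partial_grad_eq_block:
  assumes G: "(f has_derivative (\<lambda>h. G \<bullet> h)) (at x)"
  shows "partial_grad b i f x = block b i G"
  unfolding partial_grad_def
proof (rule the_equality)
  let ?f = "\<lambda>z. f (block_update b i x z)"
  let ?V = "block_space b i"
  have upd: "block_update b i x z = (x - block b i x) + block b i z" for z
    by (simp add: block_update_def block_def vec_eq_iff)
  have "bounded_linear (block b i :: real^'a \<Rightarrow> real^'a)"
    by (intro linear_conv_bounded_linear[THEN iffD1] linearI)
       (auto simp: block_def vec_eq_iff)
  then have "(block_update b i x has_derivative block b i) (at (block b i x) within ?V)"
    unfolding upd[abs_def]
    using has_derivative_add[OF has_derivative_const bounded_linear_imp_has_derivative] by fastforce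
  moreover have "block_update b i x (block b i x) = x" by (simp add: upd block_def vec_eq_iff)
  ultimately have "(?f has_derivative (\<lambda>h. G \<bullet> block b i h)) (at (block b i x) within ?V)"
    using has_derivative_compose[of "block_update b i x" "block b i" "block b i x" ?V f] G by simp
  moreover have "G \<bullet> block b i h = block b i G \<bullet> h" for h
    by (simp add: inner_vec_def block_def) (auto intro: sum.cong)
  ultimately have der: "(?f has_derivative (\<lambda>h. block b i G \<bullet> h)) (at (block b i x) within ?V)"
    by simp
  then show "block b i G \<in> ?V \<and>
      (?f has_derivative (\<lambda>h. block b i G \<bullet> h)) (at (block b i x) within ?V)"
    by simp
  fix D assume D: "D \<in> ?V \<and> (?f has_derivative (\<lambda>h. D \<bullet> h)) (at (block b i x) within ?V)"
  \<comment> \<open>The ray in direction \<open>h\<close> stays in the subspace, so both derivatives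
    apply along it; their agreement gives \<open>h \<bullet> h = 0\<close>.\<close>
  define h where "h = D - block b i G"
  have h: "h \<in> ?V" unfolding h_def using D by (intro subspace_diff subspace_block_space) auto
  have ray: "((\<lambda>t::real. block b i x + t *\<^sub>R h) has_derivative (\<lambda>t. t *\<^sub>R h)) (at 0)"
    by (auto intro!: derivative_eq_intros)
  have ray_sub: "range (\<lambda>t::real. block b i x + t *\<^sub>R h) \<subseteq> ?V"
    using h by (auto intro!: subspace_add subspace_scale subspace_block_space)
  have along: "((\<lambda>t. ?f (block b i x + t *\<^sub>R h)) has_derivative (\<lambda>t. E \<bullet> (t *\<^sub>R h))) (at 0)"
    if "(?f has_derivative (\<lambda>h. E \<bullet> h)) (at (block b i x) within ?V)" for E
    using has_derivative_in_compose[OF ray, of ?f "\<lambda>h. E \<bullet> h"]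
      has_derivative_subset[OF that ray_sub] by simp
  have "(\<lambda>t::real. D \<bullet> (t *\<^sub>R h)) = (\<lambda>t. block b i G \<bullet> (t *\<^sub>R h))"
    by (rule has_derivative_unique[OF along along]) (use D der in auto)
  from fun_cong[OF this, of 1] have "h \<bullet> h = 0" by (simp add: h_def inner_diff_left)
  then show "D = block b i G" by (simp add: h_def)
qed

text \<open>Riesz representation: the gradient is the adjoint of the derivative applied to
  1.\<close>

lemma differentiable_imp_has_gradient:
  fixes f :: "'a::euclidean_space \<Rightarrow> real"
  assumes "f differentiable (at x)"
  shows "\<exists>G. (f has_derivative (\<lambda>h. G \<bullet> h)) (at x)"
proof -
  obtain f' where f': "(f has_derivative f') (at x)" using assms unfolding differentiable_def by blast
  have "f' h = adjoint f' 1 \<bullet> h" for h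
    using adjoint_works[OF has_derivative_linear[OF f'], of h 1] by (simp add: inner_commute)
  then have "f' = (\<lambda>h. adjoint f' 1 \<bullet> h)" by blast
  then show ?thesis using f' by metis
qed

section \<open>Convex functions with blockwise Lipschitz gradient\<close>

locale block_smooth =
  fixes m :: nat and b :: "'n::finite \<Rightarrow> nat" and f :: "real ^ 'n \<Rightarrow> real"
    and G :: "real ^ 'n \<Rightarrow> real ^ 'n" and L :: "nat \<Rightarrow> real" and L_max :: real
  assumes blocks: "range b = {1..m}"
    and f_convex: "convex_on UNIV f"
    and f_gradient: "\<And>y. (f has_derivative (\<lambda>h. G y \<bullet> h)) (at y)"
    and L_pos: "\<And>i. i \<in> {1..m} \<Longrightarrow> 0 < L i"
    and L_max: "\<And>i. i \<in> {1..m} \<Longrightarrow> L i \<le> L_max"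
    and block_lipschitz: "\<And>i y h. i \<in> {1..m} \<Longrightarrow> h \<in> block_space b i \<Longrightarrow>
      norm (block b i (G (y + h)) - block b i (G y)) \<le> L i * norm h"
begin

lemma m_pos: "0 < m"
  using blocks by (cases m) auto

lemma L_max_pos: "0 < L_max"
  using L_pos[of 1] L_max[of 1] m_pos by force

lemma b_pos: "0 < b j" and b_le_m: "b j \<le> m"
proof -
  have "b j \<in> {1..m}" using blocks by blast
  then show "0 < b j" "b j \<le> m" by auto
qed

text \<open>Blocks are numbered from 1, so a sweep starts at index 1 with the old iterate and ends
  at index \<open>Suc m\<close> with the new one.\<close>

lemma splice_blocks_1: "splice_blocks b 1 y x = x"
  using b_pos by (auto simp: splice_blocks_def vec_eq_iff dest: less_imp_neq) (metis less_irrefl)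

lemma splice_blocks_Suc_m: "splice_blocks b (Suc m) y x = y"
  using b_le_m by (simp add: splice_blocks_def vec_eq_iff le_imp_less_Suc)

text \<open>Against a direction \<open>h\<close> in block \<open>i\<close> only that block of the
  gradient is seen, so \<open>block_lipschitz\<close> controls the whole ray.\<close>

lemma block_quadratic_bound:
  assumes "i \<in> {1..m}" "h \<in> block_space b i"
  shows "f (y + h) \<le> f y + G y \<bullet> h + L i / 2 * (norm h)\<^sup>2"
proof (rule lipschitz_along_ray_imp_quadratic_bound[OF f_gradient])
  fix t :: real assume t: "t \<ge> 0"
  have "(G (y + t *\<^sub>R h) - G y) \<bullet> h = (block b i (G (y + t *\<^sub>R h)) - block b i (G y)) \<bullet> h"
    using inner_block_eq[OF assms(2)] by (simp add: inner_diff_left)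
  also have "\<dots> \<le> norm (block b i (G (y + t *\<^sub>R h)) - block b i (G y)) * norm h"
    by (rule norm_cauchy_schwarz)
  also have "\<dots> \<le> (L i * norm (t *\<^sub>R h)) * norm h"
    using assms by (intro mult_right_mono block_lipschitz subspace_scale subspace_block_space) auto
  finally show "(G (y + t *\<^sub>R h) - G y) \<bullet> h \<le> L i * t * (norm h)\<^sup>2"
    using t by (simp add: power2_eq_square)
qed

text \<open>
  Convexity upgrades blockwise smoothness to joint smoothness: \<open>y + h\<close> is the average of the
  points \<open>y + m h\<^sub>i\<close>, each of which moves a single block.
\<close>

lemma joint_quadratic_bound:
  "f (y + h) \<le> f y + G y \<bullet> h + (real m * L_max) / 2 * (norm h)\<^sup>2"
proof -
  let ?h = "\<lambda>i. real m *\<^sub>R block b i h"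
  have h: "?h i \<in> block_space b i" for i
    by (intro subspace_scale subspace_block_space) simp
  have "(\<Sum>i=1..m. (1 / real m) *\<^sub>R (y + ?h i)) = y + (\<Sum>i=1..m. block b i h)"
    using m_pos by (simp add: scaleR_add_right sum.distrib sum_constant_scaleR del: sum_constant)
  also have "\<dots> = y + h" using sum_block[of "{1..m}" b h] blocks by simp
  finally have "f (y + h) = f (\<Sum>i=1..m. (1 / real m) *\<^sub>R (y + ?h i))" by simp
  also have "\<dots> \<le> (\<Sum>i=1..m. (1 / real m) * f (y + ?h i))"
    using m_pos by (intro convex_on_sum[OF _ _ f_convex]) auto
  also have "\<dots> \<le> (\<Sum>i=1..m. (1 / real m) * (f y + G y \<bullet> ?h i + L_max / 2 * (norm (?h i))\<^sup>2))"
  proof (intro sum_mono mult_left_mono)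
    fix i assume i: "i \<in> {1..m}"
    have "L i / 2 * (norm (?h i))\<^sup>2 \<le> L_max / 2 * (norm (?h i))\<^sup>2"
      using L_max[OF i] by (intro mult_right_mono) auto
    then show "f (y + ?h i) \<le> f y + G y \<bullet> ?h i + L_max / 2 * (norm (?h i))\<^sup>2"
      using block_quadratic_bound[OF i h, of y] by linarith
  qed simp
  also have "\<dots> = (\<Sum>i=1..m. f y / real m + G y \<bullet> block b i h
      + (real m * L_max) / 2 * (norm (block b i h))\<^sup>2)"
    using m_pos by (intro sum.cong) (auto simp: field_simps power2_eq_square)
  also have "\<dots> = f y + G y \<bullet> (\<Sum>i=1..m. block b i h)
      + (real m * L_max) / 2 * (\<Sum>i=1..m. (norm (block b i h))\<^sup>2)"
    using m_pos by (simp add: sum.distrib inner_sum_right sum_distrib_left)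
  also have "\<dots> = f y + G y \<bullet> h + (real m * L_max) / 2 * (norm h)\<^sup>2"
    using sum_block[of "{1..m}" b h] sum_norm_block_power2[of "{1..m}" b h] blocks by simp
  finally show ?thesis .
qed

text \<open>Needed to compare the gradient at a new iterate with those at the partially updated
  points of the sweep.\<close>

lemma gradient_lipschitz: "norm (G y - G z) \<le> real m * L_max * norm (y - z)"
  by (rule quadratic_bound_imp_gradient_lipschitz[OF f_convex f_gradient _ joint_quadratic_bound])
     (use m_pos L_max_pos in simp)

end

section \<open>Descent and rate for the inertial scheme\<close>

text \<open>
  The set \<open>S\<close> is the effective domain of the objective, and \<open>r\<close> is the real part of the
  nonsmooth terms. The assumption \<open>prox_step\<close> is the variational inequality of the proximal step,
  which is all that the rate needs to know about the scheme.
\<close>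

locale inertial_block_prox_gradient = block_smooth m b f G L L_max
  for m b and f :: "real ^ 'n::finite \<Rightarrow> real" and G L L_max +
  fixes r :: "nat \<Rightarrow> real ^ 'n \<Rightarrow> real" and S :: "(real ^ 'n) set"
    and \<beta> \<gamma> :: "nat \<Rightarrow> nat \<Rightarrow> real" and L_min \<beta>_max c :: real
    and x :: "nat \<Rightarrow> real ^ 'n" and x_opt :: "real ^ 'n"
  assumes L_min: "0 < L_min" "\<And>i. i \<in> {1..m} \<Longrightarrow> L_min \<le> L i"
    and \<beta>_nonneg: "\<And>k i. i \<in> {1..m} \<Longrightarrow> 0 \<le> \<beta> k i"
    and \<beta>_le: "\<And>k i. i \<in> {1..m} \<Longrightarrow> \<beta> k i \<le> \<beta>_max"
    and \<beta>_max: "\<beta>_max < 1"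
    and \<beta>_decreasing: "\<And>k i. i \<in> {1..m} \<Longrightarrow> \<beta> (Suc k) i \<le> \<beta> k i"
    and c: "0 < c" "c < 1"
    and \<gamma>_eq: "\<And>k i. i \<in> {1..m} \<Longrightarrow> \<gamma> k i = 2 * (1 - \<beta> k i) * c / L i"
    and prox_step: "\<And>k i y. k \<ge> 1 \<Longrightarrow> i \<in> {1..m} \<Longrightarrow> y \<in> S \<Longrightarrow>
      r i (block b i (x (Suc k)))
        + ((1 / \<gamma> k i) *\<^sub>R (block b i (x k - x (Suc k)) + \<beta> k i *\<^sub>R block b i (x k - x (k - 1)))
           - block b i (G (splice_blocks b i (x (Suc k)) (x k)))) \<bullet> block b i (y - x (Suc k))
      \<le> r i (block b i y)"
    and x_in: "\<And>k. k \<ge> 2 \<Longrightarrow> x k \<in> S"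
    and opt_in: "x_opt \<in> S"
    and opt: "\<And>y. y \<in> S \<Longrightarrow>
      f x_opt + (\<Sum>i=1..m. r i (block b i x_opt)) \<le> f y + (\<Sum>i=1..m. r i (block b i y))"
    and bounded_sublevel: "\<And>A. \<exists>R. \<forall>y\<in>S. f y + (\<Sum>i=1..m. r i (block b i y)) \<le> A \<longrightarrow> norm y \<le> R"
begin

definition obj :: "real ^ 'n \<Rightarrow> real" where
  "obj y = f y + (\<Sum>i=1..m. r i (block b i y))"

definition \<omega> :: "nat \<Rightarrow> nat \<Rightarrow> real" where
  "\<omega> k i = \<beta> k i / (2 * \<gamma> k i)"

definition \<xi> :: "nat \<Rightarrow> real" where
  "\<xi> k = obj (x k) + (\<Sum>i=1..m. \<omega> k i * (norm (block b i (x k - x (k - 1))))\<^sup>2)"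

text \<open>The blockwise decrease coefficient \<open>(1 - c) * L i / (2 * c)\<close> with
  \<open>L i\<close> replaced by its lower bound.\<close>

definition \<kappa> :: real where
  "\<kappa> = (1 - c) * L_min / (2 * c)"

text \<open>A bound for all reciprocal step sizes \<open>1 / \<gamma> k i\<close>, uniform in
  \<open>k\<close> and \<open>i\<close>.\<close>

definition \<Gamma> :: real where
  "\<Gamma> = L_max / (2 * (1 - \<beta>_max) * c)"

lemma \<kappa>_pos: "0 < \<kappa>"
  using c L_min by (simp add: \<kappa>_def)

lemma \<Gamma>_pos: "0 < \<Gamma>"
  using c L_max_pos \<beta>_max by (simp add: \<Gamma>_def)

lemma \<beta>_less_1: "i \<in> {1..m} \<Longrightarrow> \<beta> k i < 1"
  using \<beta>_le[of i k] \<beta>_max by simp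

lemma \<gamma>_pos: "i \<in> {1..m} \<Longrightarrow> 0 < \<gamma> k i"
  using \<gamma>_eq[of i k] \<beta>_less_1[of i k] c L_pos[of i] by simp

lemma inverse_\<gamma>_le:
  assumes i: "i \<in> {1..m}"
  shows "1 / \<gamma> k i \<le> \<Gamma>"
proof -
  have "1 / \<gamma> k i = L i / (2 * (1 - \<beta> k i) * c)" by (simp add: \<gamma>_eq[OF i])
  also have "\<dots> \<le> L_max / (2 * (1 - \<beta>_max) * c)"
    using L_max[OF i] L_max_pos \<beta>_le[OF i, of k] \<beta>_max c
    by (intro frac_le mult_right_mono mult_left_mono) auto
  finally show ?thesis by (simp add: \<Gamma>_def)
qed

lemma \<omega>_nonneg: "i \<in> {1..m} \<Longrightarrow> 0 \<le> \<omega> k i"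
  using \<beta>_nonneg[of i k] \<gamma>_pos[of i k] by (simp add: \<omega>_def)

lemma \<omega>_le:
  assumes i: "i \<in> {1..m}"
  shows "\<omega> k i \<le> \<Gamma>"
proof -
  have "\<omega> k i = (\<beta> k i / 2) * (1 / \<gamma> k i)" by (simp add: \<omega>_def)
  also have "\<dots> \<le> 1 * \<Gamma>"
    using \<beta>_less_1[OF i, of k] \<gamma>_pos[OF i, of k] inverse_\<gamma>_le[OF i, of k] by (intro mult_mono) auto
  finally show ?thesis by simp
qed

text \<open>Inserting the step size makes \<open>\<omega> k i\<close> a constant multiple of
  \<open>\<beta> k i / (1 - \<beta> k i)\<close>, which is increasing in
  \<open>\<beta> k i\<close>.\<close>

lemma \<omega>_decreasing:
  assumes i: "i \<in> {1..m}"
  shows "\<omega> (Suc k) i \<le> \<omega> k i"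
proof -
  have eq: "\<omega> k i = (\<beta> k i / (1 - \<beta> k i)) * (L i / (4 * c))" for k
    by (simp add: \<omega>_def \<gamma>_eq[OF i])
  show ?thesis unfolding eq
    using \<beta>_decreasing[OF i, of k] \<beta>_less_1[OF i, of k] \<beta>_nonneg[OF i, of k] L_pos[OF i] c
    by (intro mult_right_mono frac_le) auto
qed

lemma \<xi>_ge_obj: "obj (x k) \<le> \<xi> k"
  unfolding \<xi>_def by (auto intro!: sum_nonneg mult_nonneg_nonneg \<omega>_nonneg)

text \<open>
  The step sizes make the coefficient of \<open>\<parallel>d\<^sub>i\<parallel>\<^sup>2\<close> equal to
  \<open>L\<^sub>i / 2 - (1 - \<beta>\<^sub>i) / \<gamma>\<^sub>i = - (1 - c) L\<^sub>i / (2 c)\<close>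
  once the inertial cross term is split by the arithmetic-geometric mean inequality.
\<close>

lemma \<xi>_descent:
  assumes k: "k \<ge> 2"
  shows "\<xi> (Suc k) \<le> \<xi> k - \<kappa> * (norm (x (Suc k) - x k))\<^sup>2"
proof -
  let ?w = "\<lambda>i. splice_blocks b i (x (Suc k)) (x k)"
  let ?d = "\<lambda>i. block b i (x (Suc k) - x k)"
  let ?e = "\<lambda>i. block b i (x k - x (k - 1))"
  let ?r = "\<lambda>k i. r i (block b i (x k))"
  have k1: "k \<ge> 1" using k by simp
  have step: "(f (?w (Suc i)) - f (?w i)) + ?r (Suc k) i + \<omega> (Suc k) i * (norm (?d i))\<^sup>2
      \<le> ?r k i + \<omega> k i * (norm (?e i))\<^sup>2 - \<kappa> * (norm (?d i))\<^sup>2" if i: "i \<in> {1..m}" for i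
  proof -
    have \<gamma>: "\<gamma> k i > 0" by (rule \<gamma>_pos[OF i])
    have "f (?w (Suc i)) \<le> f (?w i) + G (?w i) \<bullet> ?d i + L i / 2 * (norm (?d i))\<^sup>2"
      unfolding splice_blocks_Suc by (rule block_quadratic_bound[OF i]) simp
    moreover
    have neg: "block b i (x k - x (Suc k)) = - ?d i" by (simp add: block_diff)
    \<comment> \<open>The test point is the current iterate, known to lie in \<open>S\<close> from
      \<open>k = 2\<close> on.\<close>
    have "?r (Suc k) i + ((1 / \<gamma> k i) *\<^sub>R (- ?d i + \<beta> k i *\<^sub>R ?e i) - block b i (G (?w i))) \<bullet> (- ?d i)
        \<le> ?r k i"
      using prox_step[OF k1 i x_in[OF k]] unfolding neg .
    then have "?r (Suc k) i + (1 / \<gamma> k i) * (norm (?d i))\<^sup>2 - (\<beta> k i / \<gamma> k i) * (?e i \<bullet> ?d i)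
        + G (?w i) \<bullet> ?d i \<le> ?r k i"
      by (simp add: inner_diff_left inner_add_left inner_block_eq power2_norm_eq_inner
          diff_divide_distrib distrib_left right_diff_distrib)
    moreover have "(\<beta> k i / \<gamma> k i) * (?e i \<bullet> ?d i) \<le> \<omega> k i * ((norm (?d i))\<^sup>2 + (norm (?e i))\<^sup>2)"
    proof -
      have "?e i \<bullet> ?d i \<le> norm (?e i) * norm (?d i)" by (rule norm_cauchy_schwarz)
      also have "\<dots> \<le> ((norm (?d i))\<^sup>2 + (norm (?e i))\<^sup>2) / 2"
        using sum_squares_bound[of "norm (?e i)" "norm (?d i)"] by simp
      finally have "(\<beta> k i / \<gamma> k i) * (?e i \<bullet> ?d i)
          \<le> (\<beta> k i / \<gamma> k i) * (((norm (?d i))\<^sup>2 + (norm (?e i))\<^sup>2) / 2)"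
        using \<beta>_nonneg[OF i] \<gamma> by (intro mult_left_mono) auto
      then show ?thesis by (simp add: \<omega>_def)
    qed
    moreover have "(L i / 2 - 1 / \<gamma> k i + 2 * \<omega> k i) * (norm (?d i))\<^sup>2 \<le> - \<kappa> * (norm (?d i))\<^sup>2"
    proof (rule mult_right_mono)
      have "1 / \<gamma> k i - 2 * \<omega> k i = (1 - \<beta> k i) / \<gamma> k i"
        using \<gamma> by (simp add: \<omega>_def diff_divide_distrib)
      also have "\<dots> = L i / (2 * c)"
        using \<beta>_less_1[OF i, of k] c L_pos[OF i] by (simp add: \<gamma>_eq[OF i] field_simps)
      finally have "L i / 2 - 1 / \<gamma> k i + 2 * \<omega> k i = L i / 2 - L i / (2 * c)" by simp
      also have "\<dots> = - ((1 - c) * L i / (2 * c))" using c by (simp add: field_simps)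
      finally have "L i / 2 - 1 / \<gamma> k i + 2 * \<omega> k i = - ((1 - c) * L i / (2 * c))" .
      moreover have "(1 - c) * L_min / (2 * c) \<le> (1 - c) * L i / (2 * c)"
        using L_min(2)[OF i] c by (intro divide_right_mono mult_left_mono) auto
      ultimately show "L i / 2 - 1 / \<gamma> k i + 2 * \<omega> k i \<le> - \<kappa>" by (simp add: \<kappa>_def)
    qed simp
    moreover have "\<omega> (Suc k) i * (norm (?d i))\<^sup>2 \<le> \<omega> k i * (norm (?d i))\<^sup>2"
      by (intro mult_right_mono \<omega>_decreasing[OF i]) simp
    ultimately show ?thesis by (simp add: algebra_simps)
  qed
  have "(\<Sum>i=1..m. (f (?w (Suc i)) - f (?w i)) + ?r (Suc k) i + \<omega> (Suc k) i * (norm (?d i))\<^sup>2)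
      \<le> (\<Sum>i=1..m. ?r k i + \<omega> k i * (norm (?e i))\<^sup>2 - \<kappa> * (norm (?d i))\<^sup>2)"
    by (rule sum_mono) (rule step)
  \<comment> \<open>The smooth part telescopes over the sweep.\<close>
  moreover have "(\<Sum>i=1..m. f (?w (Suc i)) - f (?w i)) = f (x (Suc k)) - f (x k)"
    using sum_Suc_diff[of 1 m "\<lambda>i. f (?w i)"] m_pos splice_blocks_1 splice_blocks_Suc_m by simp
  moreover have "(\<Sum>i=1..m. \<kappa> * (norm (?d i))\<^sup>2) = \<kappa> * (norm (x (Suc k) - x k))\<^sup>2"
    using sum_norm_block_power2[of "{1..m}" b "x (Suc k) - x k"] blocks
    by (simp add: sum_distrib_left[symmetric])
  ultimately show ?thesis by (simp add: \<xi>_def obj_def sum.distrib sum_subtractf)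
qed

text \<open>The proximal inequality is tested at the minimizer and combined with the gradient
  inequality for \<open>f\<close> at the new iterate. Each block contributes the same error bound,
  hence the leading factor \<open>m\<close>.\<close>

lemma obj_gap:
  assumes k: "k \<ge> 1"
  shows "obj (x (Suc k)) - obj x_opt \<le> real m * (real m * L_max + \<Gamma>) * norm (x (Suc k) - x_opt)
    * (norm (x (Suc k) - x k) + norm (x k - x (k - 1)))"
proof -
  let ?w = "\<lambda>i. splice_blocks b i (x (Suc k)) (x k)"
  let ?d = "\<lambda>i. block b i (x (Suc k) - x k)"
  let ?e = "\<lambda>i. block b i (x k - x (k - 1))"
  let ?\<delta> = "norm (x (Suc k) - x k)" and ?\<epsilon> = "norm (x k - x (k - 1))"
  let ?p = "x (Suc k) - x_opt"
  let ?M = "real m * L_max"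
  have step: "block b i (G (x (Suc k))) \<bullet> block b i ?p
      + (r i (block b i (x (Suc k))) - r i (block b i x_opt))
      \<le> (?M + \<Gamma>) * norm ?p * (?\<delta> + ?\<epsilon>)" if i: "i \<in> {1..m}" for i
  proof -
    have \<gamma>: "\<gamma> k i > 0" by (rule \<gamma>_pos[OF i])
    have neg: "block b i (x k - x (Suc k)) = - ?d i" "block b i (x_opt - x (Suc k)) = - block b i ?p"
      by (simp_all add: block_diff)
    \<comment> \<open>The error splits into \<open>?u\<close>, the gradient change since the partial
      update, and \<open>?v\<close>, the scaled displacement with its inertial correction.\<close>
    let ?u = "block b i (G (x (Suc k)) - G (?w i))"
    let ?v = "(1 / \<gamma> k i) *\<^sub>R (- ?d i + \<beta> k i *\<^sub>R ?e i)"
    have u: "?u = block b i (G (x (Suc k))) - block b i (G (?w i))" by (rule block_diff)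
    have "r i (block b i (x (Suc k))) + (?v - block b i (G (?w i))) \<bullet> (- block b i ?p)
        \<le> r i (block b i x_opt)"
      using prox_step[OF k i opt_in] unfolding neg .
    then have "block b i (G (x (Suc k))) \<bullet> block b i ?p
        + (r i (block b i (x (Suc k))) - r i (block b i x_opt)) \<le> (?u + ?v) \<bullet> block b i ?p"
      unfolding u by (simp add: inner_diff_left inner_add_left)
    also have "\<dots> \<le> norm (?u + ?v) * norm (block b i ?p)" by (rule norm_cauchy_schwarz)
    also have "\<dots> \<le> (?M * (?\<delta> + ?\<epsilon>) + \<Gamma> * (?\<delta> + ?\<epsilon>)) * norm ?p"
    proof (intro mult_mono order_trans[OF norm_triangle_ineq] add_mono norm_block_le)
      have "norm ?u \<le> norm (G (x (Suc k)) - G (?w i))" by (rule norm_block_le)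
      also have "\<dots> \<le> ?M * norm (x (Suc k) - ?w i)" by (rule gradient_lipschitz)
      also have "\<dots> \<le> ?M * (?\<delta> + ?\<epsilon>)"
        using L_max_pos norm_diff_splice_blocks_le[of "x (Suc k)" b i "x k"]
        by (intro mult_left_mono) (auto intro: add_increasing2)
      finally show "norm ?u \<le> ?M * (?\<delta> + ?\<epsilon>)" .
      have "norm (\<beta> k i *\<^sub>R ?e i) \<le> 1 * ?\<epsilon>"
        unfolding norm_scaleR using \<beta>_nonneg[OF i, of k] \<beta>_less_1[OF i, of k]
        by (intro mult_mono norm_block_le) auto
      then have "norm (- ?d i + \<beta> k i *\<^sub>R ?e i) \<le> ?\<delta> + ?\<epsilon>"
        by (intro order_trans[OF norm_triangle_ineq] add_mono) (simp_all add: norm_block_le)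
      then show "norm ?v \<le> \<Gamma> * (?\<delta> + ?\<epsilon>)"
        unfolding norm_scaleR using inverse_\<gamma>_le[OF i, of k] \<gamma> \<Gamma>_pos
        by (intro mult_mono) auto
    qed (use \<Gamma>_pos L_max_pos in auto)
    finally show ?thesis by (simp add: algebra_simps)
  qed
  have "f (x (Suc k)) - f x_opt \<le> G (x (Suc k)) \<bullet> ?p"
    using convex_gradient_inequality[OF f_convex f_gradient, of "x (Suc k)" x_opt]
    by (simp add: inner_diff_right)
  also have "\<dots> = (\<Sum>i=1..m. block b i (G (x (Suc k))) \<bullet> block b i ?p)"
    using sum_inner_block[of "{1..m}" b] blocks by simp
  finally have "obj (x (Suc k)) - obj x_opt \<le> (\<Sum>i=1..m. block b i (G (x (Suc k))) \<bullet> block b i ?p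
      + (r i (block b i (x (Suc k))) - r i (block b i x_opt)))"
    by (simp add: obj_def sum.distrib sum_subtractf)
  also have "\<dots> \<le> (\<Sum>i=1..m. (?M + \<Gamma>) * norm ?p * (?\<delta> + ?\<epsilon>))"
    by (rule sum_mono) (rule step)
  finally show ?thesis by (simp add: mult.assoc)
qed

lemma \<xi>_le_\<xi>_2: "k \<ge> 2 \<Longrightarrow> \<xi> k \<le> \<xi> 2"
proof (induction k rule: dec_induct)
  case (step n)
  have "0 \<le> \<kappa> * (norm (x (Suc n) - x n))\<^sup>2" using \<kappa>_pos by simp
  then show ?case using step \<xi>_descent[of n] by linarith
qed simp

lemma obj_rate: "\<exists>D>0. \<forall>k\<ge>2. obj (x k) - obj x_opt \<le> D / real k"
proof -
  obtain R0 where R0: "\<And>y. y \<in> S \<Longrightarrow> obj y \<le> \<xi> 2 \<Longrightarrow> norm y \<le> R0"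
    using bounded_sublevel[of "\<xi> 2"] unfolding obj_def by blast
  have xR: "norm (x k) \<le> R0" if "k \<ge> 2" for k
    using R0[OF x_in[OF that]] \<xi>_ge_obj[of k] \<xi>_le_\<xi>_2[OF that] by simp
  have opt_R: "norm x_opt \<le> R0"
    using R0[OF opt_in] opt[OF x_in[of 2]] \<xi>_ge_obj[of 2] unfolding obj_def by simp
  \<comment> \<open>\<open>2 * R0\<close> bounds all distances between points of the sublevel set;
    adding 1 makes \<open>R\<close> positive.\<close>
  define R where "R = 2 * R0 + 1"
  have R: "R > 0" using order_trans[OF norm_ge_zero xR[of 2]] by (simp add: R_def)
  have diff_R: "norm (u - v) \<le> R" if "norm u \<le> R0" "norm v \<le> R0" for u v :: "real^'n"
    using norm_triangle_ineq4[of u v] that by (simp add: R_def)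
  \<comment> \<open>The first summand accounts for the objective gap, the second for the inertial
    terms in \<open>\<xi>\<close>.\<close>
  define B where "B = real m * (real m * L_max + \<Gamma>) * R + \<Gamma> * R"
  have B: "B > 0" using \<Gamma>_pos L_max_pos R by (simp add: B_def add_nonneg_pos)
  define a where "a k = \<xi> k - obj x_opt" for k
  have obj_opt_le: "obj x_opt \<le> obj (x k)" if "k \<ge> 2" for k
    using opt[OF x_in[OF that]] by (simp add: obj_def)
  \<comment> \<open>The gap at \<open>n + 2\<close> involves two successive increments, so two
    descent steps are needed to absorb their squares.\<close>
  have rec: "(a (n + 2))\<^sup>2 \<le> (2 * B\<^sup>2 / \<kappa>) * (a n - a (n + 2))" if n: "n \<ge> 2" for n
  proof -
    let ?\<delta> = "norm (x (n + 2) - x (n + 1))" and ?\<epsilon> = "norm (x (n + 1) - x n)"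
    have "obj (x (n + 2)) - obj x_opt
        \<le> real m * (real m * L_max + \<Gamma>) * norm (x (n + 2) - x_opt) * (?\<delta> + ?\<epsilon>)"
      using obj_gap[of "Suc n"] by simp
    also have "\<dots> \<le> real m * (real m * L_max + \<Gamma>) * R * (?\<delta> + ?\<epsilon>)"
      using n diff_R[OF xR opt_R, of "n + 2"] \<Gamma>_pos L_max_pos
      by (intro mult_right_mono mult_left_mono) auto
    finally have 1: "obj (x (n + 2)) - obj x_opt \<le> real m * (real m * L_max + \<Gamma>) * R * (?\<delta> + ?\<epsilon>)" .
    have "(\<Sum>i=1..m. \<omega> (n + 2) i * (norm (block b i (x (n + 2) - x (n + 1))))\<^sup>2)
        \<le> (\<Sum>i=1..m. \<Gamma> * (norm (block b i (x (n + 2) - x (n + 1))))\<^sup>2)"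
      by (intro sum_mono mult_right_mono \<omega>_le) auto
    also have "\<dots> = \<Gamma> * ?\<delta>\<^sup>2"
      using sum_norm_block_power2[of "{1..m}" b "x (n + 2) - x (n + 1)"] blocks
      by (simp add: sum_distrib_left[symmetric])
    \<comment> \<open>One factor of the square is bounded by \<open>R\<close>, which leaves a bound
      linear in the increments.\<close>
    also have "\<dots> \<le> \<Gamma> * (R * (?\<delta> + ?\<epsilon>))"
      unfolding power2_eq_square
      using n diff_R[OF xR xR, of "n + 2" "n + 1"] \<Gamma>_pos R by (intro mult_left_mono mult_mono) auto
    finally have "a (n + 2) \<le> B * (?\<delta> + ?\<epsilon>)"
      using 1 by (simp add: a_def \<xi>_def B_def distrib_right mult.assoc)
    moreover have "0 \<le> a (n + 2)"
      using obj_opt_le[of "n + 2"] \<xi>_ge_obj[of "n + 2"] by (simp add: a_def)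
    ultimately have "(a (n + 2))\<^sup>2 \<le> (B * (?\<delta> + ?\<epsilon>))\<^sup>2" by (rule power_mono)
    also have "\<dots> \<le> B\<^sup>2 * (2 * (?\<delta>\<^sup>2 + ?\<epsilon>\<^sup>2))"
      unfolding power_mult_distrib using sum_squares_bound[of ?\<delta> ?\<epsilon>]
      by (intro mult_left_mono) (auto simp: power2_sum)
    also have "\<dots> = (2 * B\<^sup>2 / \<kappa>) * (\<kappa> * ?\<delta>\<^sup>2 + \<kappa> * ?\<epsilon>\<^sup>2)"
      using \<kappa>_pos by (simp add: field_simps)
    also have "\<dots> \<le> (2 * B\<^sup>2 / \<kappa>) * (a n - a (n + 2))"
      using \<xi>_descent[of n] \<xi>_descent[of "Suc n"] n \<kappa>_pos
      by (intro mult_left_mono) (auto simp: a_def)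
    finally show ?thesis .
  qed
  obtain D where D: "D > 0" "\<And>n. a (2 + n) \<le> D / real (n + 1)"
    using sublinear_rate_of_delayed_quadratic_decrease[of "2 * B\<^sup>2 / \<kappa>" 2 a] rec B \<kappa>_pos
    by auto
  \<comment> \<open>The start at index 2 yields \<open>D / (k - 1)\<close>, and
    \<open>k \<le> 2 * (k - 1)\<close> for \<open>k \<ge> 2\<close>.\<close>
  have "obj (x k) - obj x_opt \<le> (2 * D) / real k" if k: "k \<ge> 2" for k
  proof -
    have "obj (x k) - obj x_opt \<le> a (2 + (k - 2))" using k \<xi>_ge_obj[of k] le_add_diff_inverse[of 2 k] by (simp add: a_def del: add_2_eq_Suc)
    also have "\<dots> \<le> D / real (k - 2 + 1)" by (rule D)
    also have "\<dots> \<le> (2 * D) / real k"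
      using k D(1) by (simp add: field_simps of_nat_diff)
    finally show ?thesis .
  qed
  then show ?thesis using D(1) by (intro exI[of _ "2 * D"]) auto
qed

end

section \<open>Passage from extended-real data to the real-valued setting\<close>

theorem theorem4:
  fixes m :: nat
    and b :: "'n::finite \<Rightarrow> nat"
    and f :: "real ^ 'n \<Rightarrow> real"
    and g :: "nat \<Rightarrow> real ^ 'n \<Rightarrow> ereal"
    and F :: "real ^ 'n \<Rightarrow> ereal"
    and L :: "nat \<Rightarrow> real"
    and \<beta> \<gamma> :: "nat \<Rightarrow> nat \<Rightarrow> real"
    and \<beta>_lo \<beta>_hi c :: real
    and x :: "nat \<Rightarrow> real ^ 'n"
  assumes blocks: "range b = {1..m}"
    and f_convex: "convex_on UNIV f"
    and f_diff: "f differentiable_on UNIV"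
    and L_pos: "\<And>i. i \<in> {1..m} \<Longrightarrow> L i > 0"
    and f_lipschitz: "\<And>i y. i \<in> {1..m} \<Longrightarrow>
      (L i)-lipschitz_on (block_space b i) (\<lambda>z. partial_grad b i f (block_update b i y z))"
    and g_proper: "\<And>i. i \<in> {1..m} \<Longrightarrow> proper_ext (block_space b i) (g i)"
    and g_lsc: "\<And>i. i \<in> {1..m} \<Longrightarrow> lsc_ext (block_space b i) (g i)"
    and g_convex: "\<And>i. i \<in> {1..m} \<Longrightarrow> convex_ext (block_space b i) (g i)"
    and F_eq: "\<And>y. F y = ereal (f y) + (\<Sum>i=1..m. g i (block b i y))"
    and F_argmin: "{z. is_arg_min F (\<lambda>_. True) z} \<noteq> {}"
    and F_min_finite: "\<bar>INF y. F y\<bar> \<noteq> \<infinity>"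
    and F_coercive: "(F \<longlongrightarrow> \<infinity>) at_infinity"
    and \<beta>_range: "\<And>k i. i \<in> {1..m} \<Longrightarrow> \<beta> k i \<in> {0..<1}"
    and \<beta>_decreasing: "\<And>i. i \<in> {1..m} \<Longrightarrow> decseq (\<lambda>k. \<beta> k i)"
    and \<beta>_lo_pos: "0 < \<beta>_lo"
    and \<beta>_bounds: "\<And>k i. i \<in> {1..m} \<Longrightarrow> \<beta>_lo \<le> \<beta> k i \<and> \<beta> k i \<le> \<beta>_hi"
    and \<beta>_hi_less: "\<beta>_hi < 1"
    and c_range: "0 < c" "c < 1"
    and \<gamma>_eq: "\<And>k i. i \<in> {1..m} \<Longrightarrow> \<gamma> k i = 2 * (1 - \<beta> k i) * c / L i"
    and scheme: "\<And>k i. k \<ge> 1 \<Longrightarrow> i \<in> {1..m} \<Longrightarrow>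
      block b i (x (k + 1)) =
        prox (block_space b i) (\<gamma> k i) (g i)
          (block b i (x k)
           - \<gamma> k i *\<^sub>R partial_grad b i f (splice_blocks b i (x (k + 1)) (x k))
           + \<beta> k i *\<^sub>R (block b i (x k) - block b i (x (k - 1))))"
  shows "(\<forall>\<^sub>F k in sequentially. F (x k) \<noteq> \<infinity>) \<and>
    (\<lambda>k. real_of_ereal (F (x k) - (INF y. F y))) \<in> O(\<lambda>k. 1 / real k)"
proof -
  have m: "0 < m" using blocks by (cases m) auto
  have "\<exists>G. (f has_derivative (\<lambda>h. G \<bullet> h)) (at y)" for y
    using f_diff by (intro differentiable_imp_has_gradient) (simp add: differentiable_on_def)
  then obtain G where G: "\<And>y. (f has_derivative (\<lambda>h. G y \<bullet> h)) (at y)" by metis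
  \<comment> \<open>\<open>real_of_ereal\<close> sends infinite values to 0, so \<open>r\<close>
    represents \<open>g\<close> only on the effective domain \<open>S\<close> defined next.\<close>
  define r where "r i v = real_of_ereal (g i v)" for i v
  define S where "S = {y. \<forall>i\<in>{1..m}. \<bar>g i (block b i y)\<bar> \<noteq> \<infinity>}"
  have F_S: "F y = ereal (f y + (\<Sum>i=1..m. r i (block b i y)))" if "y \<in> S" for y
  proof -
    have "(\<Sum>i=1..m. g i (block b i y)) = (\<Sum>i=1..m. ereal (r i (block b i y)))"
      using that by (intro sum.cong) (auto simp: S_def r_def ereal_real')
    then show ?thesis by (simp add: F_eq)
  qed
  have F_notin_S: "F y = \<infinity>" if y: "y \<notin> S" for y
  proof -
    obtain i where i: "i \<in> {1..m}" "\<bar>g i (block b i y)\<bar> = \<infinity>" using y by (auto simp: S_def)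
    moreover have "g i (block b i y) \<noteq> -\<infinity>" using g_proper[OF i(1)] by (simp add: proper_ext_def)
    ultimately have "\<exists>i\<in>{1..m}. g i (block b i y) = \<infinity>" by auto
    then have "(\<Sum>i=1..m. g i (block b i y)) = \<infinity>" unfolding sum_Pinfty by simp
    then show ?thesis by (simp add: F_eq)
  qed
  obtain x_opt where x_opt: "\<And>y. F x_opt \<le> F y"
    using F_argmin by (auto simp: is_arg_min_linorder)
  then have INF_F: "(INF y. F y) = F x_opt" by (intro antisym INF_lower INF_greatest) auto
  have opt_S: "x_opt \<in> S" using F_notin_S[of x_opt] F_min_finite unfolding INF_F by (cases "x_opt \<in> S") simp_all
  have \<gamma>_pos: "0 < \<gamma> k i" if "i \<in> {1..m}" for k i
    using \<gamma>_eq[OF that, of k] \<beta>_range[OF that, of k] c_range L_pos[OF that] by simp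
  have prox: "block b i (x (Suc k)) = prox (block_space b i) (\<gamma> k i) (g i)
      (block b i (x k) - \<gamma> k i *\<^sub>R block b i (G (splice_blocks b i (x (Suc k)) (x k)))
        + \<beta> k i *\<^sub>R block b i (x k - x (k - 1)))" if "k \<ge> 1" "i \<in> {1..m}" for k i
    using scheme[OF that] by (simp add: partial_grad_eq_block[OF G] block_diff)
  \<comment> \<open>The partial gradients are by now blocks of the full gradient \<open>G\<close>,
    so each update is a proximal step with an explicit argument.\<close>
  note prox_facts = prox_variational[OF subspace_block_space g_proper g_lsc g_convex \<gamma>_pos prox]
  interpret inertial_block_prox_gradient m b f G L "Max (L ` {1..m})" r S \<beta> \<gamma>
    "Min (L ` {1..m})" \<beta>_hi c x x_opt
  proof unfold_locales
    show "norm (block b i (G (y + h)) - block b i (G y)) \<le> L i * norm h"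
      if i: "i \<in> {1..m}" and h: "h \<in> block_space b i" for i y h
    proof -
      have "block b i y + h \<in> block_space b i"
        using h by (intro subspace_add subspace_block_space) auto
      then have "dist (partial_grad b i f (block_update b i y (block b i y + h)))
          (partial_grad b i f (block_update b i y (block b i y + 0)))
          \<le> L i * dist (block b i y + h) (block b i y + 0)"
        by (intro lipschitz_onD[OF f_lipschitz[OF i]]) auto
      then show ?thesis
        unfolding block_update_add[OF h] block_update_add[OF subspace_0[OF subspace_block_space]]
        by (simp add: partial_grad_eq_block[OF G] dist_norm)
    qed
    show "0 < Min (L ` {1..m})" using m L_pos by (subst Min_gr_iff) auto
    show "r i (block b i (x (Suc k)))
        + ((1 / \<gamma> k i) *\<^sub>R (block b i (x k - x (Suc k)) + \<beta> k i *\<^sub>R block b i (x k - x (k - 1)))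
           - block b i (G (splice_blocks b i (x (Suc k)) (x k)))) \<bullet> block b i (y - x (Suc k))
        \<le> r i (block b i y)" if k: "k \<ge> 1" and i: "i \<in> {1..m}" and y: "y \<in> S" for k i y
    proof -
      let ?G = "block b i (G (splice_blocks b i (x (Suc k)) (x k)))"
      let ?e = "\<beta> k i *\<^sub>R block b i (x k - x (k - 1))"
      let ?p = "block b i (x (Suc k))"
      have "\<bar>g i (block b i y)\<bar> \<noteq> \<infinity>" using y i by (simp add: S_def)
      then have "r i ?p + (1 / \<gamma> k i) * ((block b i (x k) - \<gamma> k i *\<^sub>R ?G + ?e - ?p) \<bullet> (block b i y - ?p))
          \<le> r i (block b i y)"
        unfolding r_def by (intro prox_facts(3) k i) auto
      moreover have "block b i (x k) - \<gamma> k i *\<^sub>R ?G + ?e - ?p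
          = (block b i (x k - x (Suc k)) + ?e) - \<gamma> k i *\<^sub>R ?G"
        by (simp add: block_diff)
      \<comment> \<open>Dividing by the step size removes it from the gradient term, giving the form
        assumed in the locale.\<close>
      moreover have "(1 / \<gamma> k i) * (((block b i (x k - x (Suc k)) + ?e) - \<gamma> k i *\<^sub>R ?G) \<bullet> v)
          = ((1 / \<gamma> k i) *\<^sub>R (block b i (x k - x (Suc k)) + ?e) - ?G) \<bullet> v" for v
        using \<gamma>_pos[OF i, of k]
        by (simp only: inner_diff_left inner_scaleR_left right_diff_distrib) simp
      ultimately show ?thesis by (simp only: block_diff[of b i y])
    qed
    show "x k \<in> S" if k: "k \<ge> 2" for k
    proof -
      \<comment> \<open>From index 2 on every block is the output of a proximal step, hence in the
        effective domain.\<close>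
      obtain n where n: "k = Suc n" "n \<ge> 1" using k by (cases k) auto
      have "\<bar>g i (block b i (x k))\<bar> \<noteq> \<infinity>" if i: "i \<in> {1..m}" for i
        unfolding n(1) by (rule prox_facts(2)[OF i i i i n(2) i])
      then show ?thesis unfolding S_def by (intro CollectI ballI)
    qed
    show "f x_opt + (\<Sum>i=1..m. r i (block b i x_opt)) \<le> f y + (\<Sum>i=1..m. r i (block b i y))"
      if "y \<in> S" for y
      using x_opt[of y] F_S[OF opt_S] F_S[OF that] by simp
    show "\<exists>R. \<forall>y\<in>S. f y + (\<Sum>i=1..m. r i (block b i y)) \<le> A \<longrightarrow> norm y \<le> R" for A
    proof -
      have "\<forall>\<^sub>F y in at_infinity. ereal A < F y" using F_coercive unfolding tendsto_PInfty by blast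
      then obtain R where R: "\<And>y. R \<le> norm y \<Longrightarrow> ereal A < F y"
        unfolding eventually_at_infinity by blast
      have "norm y \<le> R" if "y \<in> S" "f y + (\<Sum>i=1..m. r i (block b i y)) \<le> A" for y
        using R[of y] F_S[OF that(1)] that(2) by (cases "R \<le> norm y") simp_all
      then show ?thesis by blast
    qed
  qed (use blocks f_convex G L_pos \<beta>_range \<beta>_bounds \<beta>_hi_less \<beta>_decreasing c_range \<gamma>_eq opt_S
        in \<open>auto simp: decseq_Suc_iff\<close>)
  obtain D where D: "D > 0" "\<And>k. k \<ge> 2 \<Longrightarrow> obj (x k) - obj x_opt \<le> D / real k"
    using obj_rate by blast
  have F_x: "F (x k) = ereal (obj (x k))" if "k \<ge> 2" for k
    using F_S[OF x_in[OF that]] by (simp add: obj_def)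
  have gap: "real_of_ereal (F (x k) - (INF y. F y)) = obj (x k) - obj x_opt" if "k \<ge> 2" for k
    using F_x[OF that] F_S[OF opt_S] by (simp add: INF_F obj_def)
  have "(\<lambda>k. real_of_ereal (F (x k) - (INF y. F y))) \<in> O(\<lambda>k. 1 / real k)"
  proof (rule bigoI)
    show "\<forall>\<^sub>F k in sequentially.
        norm (real_of_ereal (F (x k) - (INF y. F y))) \<le> D * norm (1 / real k)"
      using eventually_ge_at_top[of 2]
    proof eventually_elim
      case (elim k)
      have "0 \<le> obj (x k) - obj x_opt" using opt[OF x_in[OF elim]] by (simp add: obj_def)
      then show ?case using D(2)[OF elim] by (simp add: gap[OF elim])
    qed
  qed
  \<comment> \<open>Finiteness is recorded separately, since \<open>real_of_ereal\<close> would turn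
    an infinite gap into 0.\<close>
  moreover have "\<forall>\<^sub>F k in sequentially. F (x k) \<noteq> \<infinity>"
    using eventually_ge_at_top[of 2] by eventually_elim (simp add: F_x)
  ultimately show ?thesis by blast
qed

end
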